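(* Let $\Lambda$ be a connected $k$-graph. Then: (i) The canonical map $\iota:\Lambda\to T(\Lambda^0)$, $\iota(\lambda)=(r(\lambda),s(\lambda))$, is injective if and only if $\Lambda$ is singly connected. (ii) If $\Lambda$ is singly connected, then $i:\Lambda\to\Pi(\Lambda)$ is injective.
   Context: A $k$-graph is a small category $\Lambda$ (identified with its set of morphisms) with a functor $d:\Lambda\to\mathbb{N}^k$ satisfying the factorisation property: if $d(\lambda)=m+n$ there are unique $\mu,\nu\in\Lambda$ with $d(\mu)=m$, $d(\nu)=n$, $\lambda=\mu\nu$. $\Lambda^0=d^{-1}(0)$ is the set of identity morphisms (vertices); $r,s:\Lambda\to\Lambda^0$ are the codomain and domain maps; $u\Lambda v=\{\lambda:r(\lambda)=u,\ s(\lambda)=v\}$. $\Lambda$ is connected if the equivalence relation on $\Lambda^0$ generated by $\{(u,v):u\Lambda v\ne\emptyset\}$ is all of $\Lambda^0\times\Lambda^0$. $\Lambda$ is singly connected if $|u\Lambda v|\le1$ for all $u,v\in\Lambda^0$. For a nonempty set $X$, $T(X)=X\times X$ is the pair groupoid: $r(x,y)=x$, $s(x,y)=y$, $(x,y)(y,z)=(x,z)$, $(x,y)^{-1}=(y,x)$. The fundamental groupoid of $\Lambda$ is a groupoid $\Pi(\Lambda)$ with a functor $i:\Lambda\to\Pi(\Lambda)$, $i(\Lambda^0)=\Pi(\Lambda)^0$, such that every functor $F$ from $\Lambda$ to a groupoid $\mathcal G$ is $\tilde F\circ i$ for a unique groupoid homomorphism $\tilde F:\Pi(\Lambda)\to\mathcal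 G$. *)

theory Defs
  imports Main "HOL-Library.FuncSet" "HOL-Library.Function_Algebras"
begin

section \<open>Small categories and groupoids\<close>

text \<open>
  A small category is identified with its set of morphisms; its objects are the identity
  morphisms, so the codomain map \<open>rng\<close> and the domain map \<open>src\<close> take values
  in morphisms. The product \<open>cmp C x y\<close> is meaningful only if \<open>src C x = rng C y\<close>.
\<close>

record 'a cat =
  mor :: "'a set"
  rng :: "'a \<Rightarrow> 'a"
  src :: "'a \<Rightarrow> 'a"
  cmp :: "'a \<Rightarrow> 'a \<Rightarrow> 'a"

locale category =
  fixes C :: "'a cat"
  assumes rng_mor: "x \<in> mor C \<Longrightarrow> rng C x \<in> mor C"
    and src_mor: "x \<in> mor C \<Longrightarrow> src C x \<in> mor C"
    and rng_rng: "x \<in> mor C \<Longrightarrow> rng C (rng C x) = rng C x"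
    and src_rng: "x \<in> mor C \<Longrightarrow> src C (rng C x) = rng C x"
    and rng_src: "x \<in> mor C \<Longrightarrow> rng C (src C x) = src C x"
    and src_src: "x \<in> mor C \<Longrightarrow> src C (src C x) = src C x"
    and cmp_mor: "\<lbrakk>x \<in> mor C; y \<in> mor C; src C x = rng C y\<rbrakk> \<Longrightarrow> cmp C x y \<in> mor C"
    and rng_cmp: "\<lbrakk>x \<in> mor C; y \<in> mor C; src C x = rng C y\<rbrakk> \<Longrightarrow> rng C (cmp C x y) = rng C x"
    and src_cmp: "\<lbrakk>x \<in> mor C; y \<in> mor C; src C x = rng C y\<rbrakk> \<Longrightarrow> src C (cmp C x y) = src C y"
    and cmp_assoc: "\<lbrakk>x \<in> mor C; y \<in> mor C; z \<in> mor C; src C x = rng C y; src C y = rng C z\<rbrakk>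
      \<Longrightarrow> cmp C (cmp C x y) z = cmp C x (cmp C y z)"
    and cmp_rng: "x \<in> mor C \<Longrightarrow> cmp C (rng C x) x = x"
    and cmp_src: "x \<in> mor C \<Longrightarrow> cmp C x (src C x) = x"

definition objs :: "'a cat \<Rightarrow> 'a set" where
  "objs C = {x \<in> mor C. rng C x = x \<and> src C x = x}"

definition hom_set :: "'a cat \<Rightarrow> 'a \<Rightarrow> 'a \<Rightarrow> 'a set" where
  "hom_set C u v = {x \<in> mor C. rng C x = u \<and> src C x = v}"

definition is_inverse :: "'a cat \<Rightarrow> 'a \<Rightarrow> 'a \<Rightarrow> bool" where
  "is_inverse C x y \<longleftrightarrow> y \<in> mor C \<and> src C x = rng C y \<and> src C y = rng C x \<and>
     cmp C x y = rng C x \<and> cmp C y x = src C x"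

locale groupoid = category +
  assumes ex_inverse: "x \<in> mor C \<Longrightarrow> \<exists>y. is_inverse C x y"

definition cat_functor :: "'a cat \<Rightarrow> 'b cat \<Rightarrow> ('a \<Rightarrow> 'b) \<Rightarrow> bool" where
  "cat_functor C D F \<longleftrightarrow>
     (\<forall>x\<in>mor C. F x \<in> mor D \<and> F (rng C x) = rng D (F x) \<and> F (src C x) = src D (F x)) \<and>
     (\<forall>x\<in>mor C. \<forall>y\<in>mor C. src C x = rng C y \<longrightarrow> F (cmp C x y) = cmp D (F x) (F y))"

text \<open>
  The unit \<open>(x, x)\<close> of the pair groupoid is the object usually identified with \<open>x\<close>.
\<close>

definition pair_groupoid :: "'x set \<Rightarrow> ('x \<times> 'x) cat" where
  "pair_groupoid X =
     \<lparr>mor = X \<times> X, rng = (\<lambda>(x, y). (x, x)), src = (\<lambda>(x, y). (y, y)),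
      cmp = (\<lambda>(x, y) (y', z). (x, z))\<rparr>"

definition iota :: "'a cat \<Rightarrow> 'a \<Rightarrow> 'a \<times> 'a" where
  "iota C x = (rng C x, src C x)"


section \<open>Higher-rank graphs\<close>

text \<open>\<open>\<nat>\<^sup>k\<close>, with componentwise addition: functions supported on \<open>{..<k}\<close>.\<close>

definition Nk :: "nat \<Rightarrow> (nat \<Rightarrow> nat) set" where
  "Nk k = {m. \<forall>j\<ge>k. m j = 0}"

locale k_graph = category L for L :: "'a cat" +
  fixes k :: nat and d :: "'a \<Rightarrow> nat \<Rightarrow> nat"
  assumes deg_Nk: "x \<in> mor L \<Longrightarrow> d x \<in> Nk k"
    and deg_obj: "x \<in> objs L \<Longrightarrow> d x = 0"
    and deg_cmp: "\<lbrakk>x \<in> mor L; y \<in> mor L; src L x = rng L y\<rbrakk> \<Longrightarrow> d (cmp L x y) = d x + d y"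
    and factorisation: "\<lbrakk>x \<in> mor L; m \<in> Nk k; n \<in> Nk k; d x = m + n\<rbrakk> \<Longrightarrow>
      \<exists>!(y, z). y \<in> mor L \<and> z \<in> mor L \<and> src L y = rng L z \<and> d y = m \<and> d z = n \<and> x = cmp L y z"

definition generated_equiv :: "'x set \<Rightarrow> ('x \<times> 'x) set \<Rightarrow> ('x \<times> 'x) set" where
  "generated_equiv X E = \<Inter>{R. equiv X R \<and> E \<subseteq> R}"

definition connected_cat :: "'a cat \<Rightarrow> bool" where
  "connected_cat C \<longleftrightarrow>
     generated_equiv (objs C) {(u, v). u \<in> objs C \<and> v \<in> objs C \<and> hom_set C u v \<noteq> {}}
       = objs C \<times> objs C"

definition singly_connected :: "'a cat \<Rightarrow> bool" where
  "singly_connected C \<longleftrightarrow>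
     (\<forall>u\<in>objs C. \<forall>v\<in>objs C. finite (hom_set C u v) \<and> card (hom_set C u v) \<le> 1)"


section \<open>The fundamental groupoid\<close>

text \<open>
  Functors are only relevant on morphisms; to make uniqueness meaningful, the mediating
  map is required to be \<open>undefined\<close> outside \<open>mor P\<close>. The type argument is
  the type in which the test groupoids live.
\<close>

definition universal_groupoid ::
    "'g itself \<Rightarrow> 'a cat \<Rightarrow> 'p cat \<Rightarrow> ('a \<Rightarrow> 'p) \<Rightarrow> bool" where
  "universal_groupoid _ L P i \<longleftrightarrow>
     (\<forall>(G :: 'g cat) F. groupoid G \<and> cat_functor L G F \<longrightarrow>
       (\<exists>!H. H \<in> extensional (mor P) \<and> cat_functor P G H \<and> (\<forall>x\<in>mor L. H (i x) = F x)))"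

text \<open>
  HOL cannot quantify over the types of the test groupoids inside a definition. Expressions
  in the generators, inverses and products are enough to name every element of a groupoid
  generated by the image of \<open>L\<close>; so testing against groupoids in the sum of this type
  and the type of \<open>P\<close> already implies the universal property for groupoids of
  every type (theorem \<open>fundamental_groupoid_universal\<close> below). Existence of a
  fundamental groupoid is \<open>fundamental_groupoid_exists\<close>.
\<close>

datatype 'a expr = Gen 'a | Inv "'a expr" | Mul "'a expr" "'a expr"

definition fundamental_groupoid :: "'a cat \<Rightarrow> 'p cat \<Rightarrow> ('a \<Rightarrow> 'p) \<Rightarrow> bool" where
  "fundamental_groupoid L P i \<longleftrightarrow>
     groupoid P \<and> cat_functor L P i \<and> i ` objs L = objs P \<and>
     universal_groupoid TYPE('p + 'a expr) L P i"


section \<open>Consistency of the definitions\<close>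

lemma (in category) rng_obj: "x \<in> mor C \<Longrightarrow> rng C x \<in> objs C"
  by (simp add: objs_def rng_mor rng_rng src_rng)

lemma (in category) src_obj: "x \<in> mor C \<Longrightarrow> src C x \<in> objs C"
  by (simp add: objs_def src_mor rng_src src_src)

lemma (in k_graph) objs_eq_degree_zero: "objs L = {x \<in> mor L. d x = 0}"
proof (intro set_eqI iffI)
  fix x assume "x \<in> objs L"
  then show "x \<in> {x \<in> mor L. d x = 0}" using deg_obj by (simp add: objs_def)
next
  fix x assume "x \<in> {x \<in> mor L. d x = 0}"
  then have x: "x \<in> mor L" "d x = 0" by auto
  let ?P = "\<lambda>(y, z). y \<in> mor L \<and> z \<in> mor L \<and> src L y = rng L z \<and> d y = 0 \<and> d z = 0 \<and> x = cmp L y z"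
  have "0 \<in> Nk k" by (simp add: Nk_def)
  then have "\<exists>!p. ?P p" using factorisation[of x 0 0] x by simp
  moreover have "?P (rng L x, x)" "?P (x, src L x)"
    using x by (simp_all add: rng_mor src_mor src_rng rng_src cmp_rng cmp_src
        deg_obj[OF rng_obj] deg_obj[OF src_obj])
  ultimately have "(rng L x, x) = (x, src L x)" by blast
  then show "x \<in> objs L" using x by (simp add: objs_def)
qed

lemma groupoid_pair_groupoid: "groupoid (pair_groupoid X)"
  by unfold_locales (auto simp: pair_groupoid_def is_inverse_def)

lemma (in category) cat_functor_iota: "cat_functor C (pair_groupoid (objs C)) (iota C)"
  by (auto simp: cat_functor_def pair_groupoid_def iota_def rng_obj src_obj
      rng_rng src_rng rng_src src_src rng_cmp src_cmp)

lemma (in groupoid) inverse_unique: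
  assumes "x \<in> mor C" "is_inverse C x y" "is_inverse C x z" shows "y = z"
proof -
  have "y = cmp C y (cmp C x z)"
    using assms cmp_src[of y] by (simp add: is_inverse_def)
  also have "\<dots> = cmp C (cmp C y x) z"
    using assms by (subst cmp_assoc) (auto simp: is_inverse_def)
  also have "\<dots> = z" using assms cmp_rng[of z] by (simp add: is_inverse_def)
  finally show ?thesis .
qed

definition inverse_of :: "'a cat \<Rightarrow> 'a \<Rightarrow> 'a" where
  "inverse_of C x = (SOME y. is_inverse C x y)"

lemma (in groupoid) is_inverse_inverse_of: "x \<in> mor C \<Longrightarrow> is_inverse C x (inverse_of C x)"
  unfolding inverse_of_def by (rule someI_ex) (rule ex_inverse)

lemma (in groupoid) inverse_of_eq: "x \<in> mor C \<Longrightarrow> is_inverse C x y \<Longrightarrow> inverse_of C x = y"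
  using inverse_unique is_inverse_inverse_of by blast

lemma functor_inverse:
  assumes "groupoid C" "groupoid D" "cat_functor C D F" "x \<in> mor C"
  shows "F (inverse_of C x) = inverse_of D (F x)"
proof -
  have "is_inverse C x (inverse_of C x)"
    using assms(1,4) by (rule groupoid.is_inverse_inverse_of)
  then have "is_inverse D (F x) (F (inverse_of C x))"
    using assms(3,4) unfolding cat_functor_def is_inverse_def by metis
  moreover have "F x \<in> mor D" using assms(3,4) by (simp add: cat_functor_def)
  ultimately show ?thesis using groupoid.inverse_of_eq[OF assms(2)] by simp
qed

lemma cat_functor_cong:
  assumes "category C" "\<And>x. x \<in> mor C \<Longrightarrow> F x = F' x"
  shows "cat_functor C D F = cat_functor C D F'"
proof -
  interpret category C by fact
  show ?thesis
    unfolding cat_functor_def using assms(2) rng_mor src_mor cmp_mor by simp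
qed

lemma cat_functor_comp:
  assumes "cat_functor C D F" "cat_functor D E G"
  shows "cat_functor C E (G \<circ> F)"
  using assms unfolding cat_functor_def by (simp, metis)


subsection \<open>Generated subgroupoids\<close>

inductive_set gen :: "'b cat \<Rightarrow> 'b set \<Rightarrow> 'b set" for G :: "'b cat" and S :: "'b set" where
  gen_base: "x \<in> S \<Longrightarrow> x \<in> gen G S"
| gen_inv: "x \<in> gen G S \<Longrightarrow> inverse_of G x \<in> gen G S"
| gen_cmp: "x \<in> gen G S \<Longrightarrow> y \<in> gen G S \<Longrightarrow> src G x = rng G y \<Longrightarrow> cmp G x y \<in> gen G S"

abbreviation gen_groupoid :: "'b cat \<Rightarrow> 'b set \<Rightarrow> 'b cat" where
  "gen_groupoid G S \<equiv> G\<lparr>mor := gen G S\<rparr>"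

lemma gen_mor:
  assumes "groupoid G" "S \<subseteq> mor G" "x \<in> gen G S"
  shows "x \<in> mor G"
  using assms(3)
proof induction
  case (gen_base x) then show ?case using assms(2) by blast
next
  case (gen_inv x) then show ?case
    using groupoid.is_inverse_inverse_of[OF assms(1)] by (simp add: is_inverse_def)
next
  case (gen_cmp x y)
  interpret groupoid G by fact
  show ?case using gen_cmp cmp_mor by simp
qed

lemma groupoid_gen:
  assumes "groupoid G" "S \<subseteq> mor G"
  shows "groupoid (gen_groupoid G S)"
proof -
  interpret G: groupoid G by fact
  note m = gen_mor[OF assms]
  have inv: "is_inverse G x (inverse_of G x)" if "x \<in> gen G S" for x
    using G.is_inverse_inverse_of m that by blast
  have r: "rng G x \<in> gen G S" if "x \<in> gen G S" for x
    using gen_cmp[OF that gen_inv[OF that]] inv[OF that] by (simp add: is_inverse_def)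
  have s: "src G x \<in> gen G S" if "x \<in> gen G S" for x
    using gen_cmp[OF gen_inv[OF that] that] inv[OF that] by (simp add: is_inverse_def)
  show ?thesis
  proof unfold_locales
    fix x assume "x \<in> mor (gen_groupoid G S)"
    then show "\<exists>y. is_inverse (gen_groupoid G S) x y"
      using inv[of x] gen_inv[of x G S]
      by (auto simp: is_inverse_def intro!: exI[of _ "inverse_of G x"])
  qed (use m r s in \<open>auto simp: G.rng_rng G.src_rng G.rng_src G.src_src G.rng_cmp G.src_cmp
        G.cmp_assoc G.cmp_rng G.cmp_src intro: gen_cmp\<close>)
qed

lemma functor_into_gen:
  assumes "cat_functor L G F"
  shows "cat_functor L (gen_groupoid G (F ` mor L)) F"
  using assms by (auto simp: cat_functor_def intro: gen_base)

lemma functor_from_gen: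
  assumes "groupoid G" "S \<subseteq> mor G"
  shows "cat_functor (gen_groupoid G S) G (\<lambda>x. x)"
  using gen_mor[OF assms] by (auto simp: cat_functor_def)

lemma functors_agree_on_gen:
  assumes "groupoid P" "groupoid G" "S \<subseteq> mor P" "cat_functor P G H" "cat_functor P G K"
    and "\<And>x. x \<in> S \<Longrightarrow> H x = K x" and "x \<in> gen P S"
  shows "H x = K x"
  using assms(7)
proof induction
  case (gen_base x) then show ?case using assms(6) by blast
next
  case (gen_inv x)
  then show ?case
    using functor_inverse[OF assms(1,2,4)] functor_inverse[OF assms(1,2,5)] gen_mor[OF assms(1,3)]
    by simp
next
  case (gen_cmp x y)
  then show ?case using assms(4,5) gen_mor[OF assms(1,3)] by (simp add: cat_functor_def)
qed

primrec eval_expr :: "'b cat \<Rightarrow> ('a \<Rightarrow> 'b) \<Rightarrow> 'a expr \<Rightarrow> 'b" where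
  "eval_expr G F (Gen a) = F a"
| "eval_expr G F (Inv t) = inverse_of G (eval_expr G F t)"
| "eval_expr G F (Mul t u) = cmp G (eval_expr G F t) (eval_expr G F u)"

lemma gen_subset_range_eval: "x \<in> gen G (F ` A) \<Longrightarrow> x \<in> range (eval_expr G F)"
proof (induction rule: gen.induct)
  case (gen_base x)
  then obtain a where "x = F a" by blast
  then show ?case by (intro range_eqI[of _ _ "Gen a"]) simp
next
  case (gen_inv x)
  then obtain t where "x = eval_expr G F t" by blast
  then show ?case by (intro range_eqI[of _ _ "Inv t"]) simp
next
  case (gen_cmp x y)
  then obtain t u where "x = eval_expr G F t" "y = eval_expr G F u" by blast
  then show ?case by (intro range_eqI[of _ _ "Mul t u"]) simp
qed

lemma gen_embeds_expr:
  fixes F :: "'a \<Rightarrow> 'b"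
  shows "\<exists>f :: 'b \<Rightarrow> 'a expr. inj_on f (gen G (F ` A))"
proof -
  have "gen G (F ` A) \<subseteq> range (eval_expr G F)" by (intro subsetI gen_subset_range_eval)
  then show ?thesis using inj_on_inv_into by blast
qed


subsection \<open>Transport along injections\<close>

definition transport :: "('b \<Rightarrow> 'u) \<Rightarrow> 'b cat \<Rightarrow> 'u cat" where
  "transport f G = (let g = inv_into (mor G) f in
     \<lparr>mor = f ` mor G, rng = (\<lambda>x. f (rng G (g x))), src = (\<lambda>x. f (src G (g x))),
      cmp = (\<lambda>x y. f (cmp G (g x) (g y)))\<rparr>)"

lemma
  assumes "groupoid G" "inj_on f (mor G)"
  shows groupoid_transport: "groupoid (transport f G)"
    and functor_transport: "cat_functor G (transport f G) f"
    and functor_transport_inv: "cat_functor (transport f G) G (inv_into (mor G) f)"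
proof -
  interpret G: groupoid G by fact
  have g: "inv_into (mor G) f (f x) = x" if "x \<in> mor G" for x
    using assms(2) that by simp
  have e: "f x = f y \<longleftrightarrow> x = y" if "x \<in> mor G" "y \<in> mor G" for x y
    using assms(2) that by (meson inj_on_eq_iff)
  note simps = transport_def Let_def g e G.rng_mor G.src_mor G.cmp_mor G.rng_rng G.src_rng
    G.rng_src G.src_src G.rng_cmp G.src_cmp G.cmp_assoc G.cmp_rng G.cmp_src
  show "groupoid (transport f G)"
  proof unfold_locales
    fix x assume "x \<in> mor (transport f G)"
    then obtain a where a: "a \<in> mor G" "x = f a" by (auto simp: transport_def Let_def)
    obtain b where "is_inverse G a b" using a G.ex_inverse by blast
    then have "is_inverse (transport f G) x (f b)"
      using a by (auto simp: is_inverse_def simps)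
    then show "\<exists>y. is_inverse (transport f G) x y" ..
  qed (auto simp: simps)
  show "cat_functor G (transport f G) f" by (auto simp: cat_functor_def simps)
  show "cat_functor (transport f G) G (inv_into (mor G) f)"
    by (auto simp: cat_functor_def simps)
qed


subsection \<open>The universal property for all types\<close>

lemma universal_groupoidD:
  assumes "universal_groupoid TYPE('g) L P i" "groupoid (G :: 'g cat)" "cat_functor L G F"
  obtains H where "cat_functor P G H" "\<And>x. x \<in> mor L \<Longrightarrow> H (i x) = F x"
  using assms unfolding universal_groupoid_def by blast

lemma fundamental_groupoid_generated:
  fixes P :: "'p cat" and L :: "'a cat"
  assumes "fundamental_groupoid L P i"
  shows "gen P (i ` mor L) = mor P"
proof -
  have P: "groupoid P" and i: "cat_functor L P i"
    and U: "universal_groupoid TYPE('p + 'a expr) L P i"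
    using assms by (auto simp: fundamental_groupoid_def)
  have cP: "category P" using P by (rule groupoid.axioms)
  have S: "i ` mor L \<subseteq> mor P" using i by (auto simp: cat_functor_def)
  define Q where "Q = gen_groupoid P (i ` mor L)"
  define f :: "'p \<Rightarrow> 'p + 'a expr" where "f = Inl"
  have f: "inj_on f A" for A by (simp add: f_def inj_on_def)
  have Q: "groupoid Q" using groupoid_gen[OF P S] by (simp add: Q_def)
  have iQ: "cat_functor L Q i" using functor_into_gen[OF i] by (simp add: Q_def)
  have inc: "cat_functor Q P (\<lambda>x. x)" using functor_from_gen[OF P S] by (simp add: Q_def)
  have mQ: "mor Q = gen P (i ` mor L)" by (simp add: Q_def)
  obtain H where H: "cat_functor P (transport f Q) H" "\<And>x. x \<in> mor L \<Longrightarrow> H (i x) = f (i x)"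
    using universal_groupoidD[OF U groupoid_transport[OF Q f]
        cat_functor_comp[OF iQ functor_transport[OF Q f]]] by auto
  define g where "g = inv_into (mor Q) f"
  have r: "cat_functor P Q (g \<circ> H)"
    unfolding g_def by (rule cat_functor_comp[OF H(1) functor_transport_inv[OF Q f]])
  have "cat_functor P P (g \<circ> H)"
    using cat_functor_comp[OF r inc] by (simp add: comp_def)
  then have 1: "cat_functor P (transport f P) (f \<circ> (g \<circ> H))"
    by (rule cat_functor_comp) (rule functor_transport[OF P f])
  have 2: "cat_functor P (transport f P) f" by (rule functor_transport[OF P f])
  have giH: "g (H (i x)) = i x" if "x \<in> mor L" for x
    using H(2)[OF that] iQ that f[of "mor Q"] by (simp add: g_def cat_functor_def)
  have "restrict (f \<circ> (g \<circ> H)) (mor P) = restrict f (mor P)"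
  proof -
    have "\<exists>!K. K \<in> extensional (mor P) \<and> cat_functor P (transport f P) K
        \<and> (\<forall>x\<in>mor L. K (i x) = (f \<circ> i) x)"
      using U groupoid_transport[OF P f] cat_functor_comp[OF i functor_transport[OF P f]]
      unfolding universal_groupoid_def by blast
    moreover have "cat_functor P (transport f P) (restrict (f \<circ> (g \<circ> H)) (mor P))"
      "cat_functor P (transport f P) (restrict f (mor P))"
      using 1 2 cat_functor_cong[OF cP, of "restrict _ (mor P)"] by (metis restrict_apply')+
    moreover have "\<forall>x\<in>mor L. restrict (f \<circ> (g \<circ> H)) (mor P) (i x) = (f \<circ> i) x"
      "\<forall>x\<in>mor L. restrict f (mor P) (i x) = (f \<circ> i) x"
      using S giH by auto
    ultimately show ?thesis by (metis restrict_extensional)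
  qed
  then have id: "g (H x) = x" if "x \<in> mor P" for x
    using that f[of UNIV] by (metis comp_apply injD restrict_apply')
  have "x \<in> gen P (i ` mor L)" if "x \<in> mor P" for x
    using id[OF that] r that unfolding mQ[symmetric] by (metis cat_functor_def comp_apply)
  then show ?thesis using gen_mor[OF P S] by blast
qed

lemma universal_groupoid_generated:
  fixes P :: "'p cat" and L :: "'a cat"
  assumes P: "groupoid P" and i: "cat_functor L P i" and gen: "gen P (i ` mor L) = mor P"
    and ex: "\<And>(G :: 'a expr cat) F. groupoid G \<Longrightarrow> cat_functor L G F \<Longrightarrow>
      \<exists>H. cat_functor P G H \<and> (\<forall>x\<in>mor L. H (i x) = F x)"
  shows "universal_groupoid TYPE('g) L P i"
  unfolding universal_groupoid_def
proof (intro allI impI, elim conjE)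
  fix G :: "'g cat" and F assume G: "groupoid G" and F: "cat_functor L G F"
  have cP: "category P" using P by (rule groupoid.axioms)
  have S: "i ` mor L \<subseteq> mor P" using i by (auto simp: cat_functor_def)
  have SG: "F ` mor L \<subseteq> mor G" using F by (auto simp: cat_functor_def)
  define Q where "Q = gen_groupoid G (F ` mor L)"
  have Q: "groupoid Q" using groupoid_gen[OF G SG] by (simp add: Q_def)
  have FQ: "cat_functor L Q F" using functor_into_gen[OF F] by (simp add: Q_def)
  have inc: "cat_functor Q G (\<lambda>x. x)" using functor_from_gen[OF G SG] by (simp add: Q_def)
  obtain f :: "'g \<Rightarrow> 'a expr" where f: "inj_on f (mor Q)"
    using gen_embeds_expr[of G F "mor L"] by (auto simp: Q_def)
  obtain H where H: "cat_functor P (transport f Q) H" "\<forall>x\<in>mor L. H (i x) = (f \<circ> F) x"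
    using ex[OF groupoid_transport[OF Q f] cat_functor_comp[OF FQ functor_transport[OF Q f]]]
    by blast
  define K where "K = inv_into (mor Q) f \<circ> H"
  have "cat_functor P Q K"
    unfolding K_def by (rule cat_functor_comp[OF H(1) functor_transport_inv[OF Q f]])
  from cat_functor_comp[OF this inc] have K: "cat_functor P G K" by (simp add: comp_def)
  have KF: "K (i x) = F x" if "x \<in> mor L" for x
    using that H(2) FQ f by (simp add: K_def cat_functor_def)
  show "\<exists>!H. H \<in> extensional (mor P) \<and> cat_functor P G H \<and> (\<forall>x\<in>mor L. H (i x) = F x)"
  proof (rule ex1I[of _ "restrict K (mor P)"])
    show "restrict K (mor P) \<in> extensional (mor P) \<and> cat_functor P G (restrict K (mor P)) \<and>
        (\<forall>x\<in>mor L. restrict K (mor P) (i x) = F x)"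
      using K KF S cat_functor_cong[OF cP, of "restrict K (mor P)" K] by auto
  next
    fix H' assume H': "H' \<in> extensional (mor P) \<and> cat_functor P G H' \<and> (\<forall>x\<in>mor L. H' (i x) = F x)"
    show "H' = restrict K (mor P)"
    proof
      fix x show "H' x = restrict K (mor P) x"
      proof (cases "x \<in> mor P")
        case True
        have "H' x = K x"
          by (rule functors_agree_on_gen[OF P G S _ K]) (use H' KF True gen in auto)
        then show ?thesis using True by simp
      next
        case False then show ?thesis using H' by (simp add: extensional_def)
      qed
    qed
  qed
qed

theorem fundamental_groupoid_universal:
  fixes P :: "'p cat" and L :: "'a cat"
  assumes "fundamental_groupoid L P i"
  shows "universal_groupoid TYPE('g) L P i"
proof (rule universal_groupoid_generated)
  show "groupoid P" "cat_functor L P i" "gen P (i ` mor L) = mor P"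
    using assms fundamental_groupoid_generated[OF assms] by (auto simp: fundamental_groupoid_def)
  fix G :: "'a expr cat" and F assume G: "groupoid G" and F: "cat_functor L G F"
  define f :: "'a expr \<Rightarrow> 'p + 'a expr" where "f = Inr"
  have f: "inj_on f (mor G)" by (simp add: f_def inj_on_def)
  have "universal_groupoid TYPE('p + 'a expr) L P i"
    using assms by (simp add: fundamental_groupoid_def)
  then obtain H where H: "cat_functor P (transport f G) H" "\<And>x. x \<in> mor L \<Longrightarrow> H (i x) = (f \<circ> F) x"
    using universal_groupoidD[OF _ groupoid_transport[OF G f]
        cat_functor_comp[OF F functor_transport[OF G f]]] by blast
  have "cat_functor P G (inv_into (mor G) f \<circ> H)"
    by (rule cat_functor_comp[OF H(1) functor_transport_inv[OF G f]])
  moreover have "\<forall>x\<in>mor L. (inv_into (mor G) f \<circ> H) (i x) = F x"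
    using H(2) f F by (simp add: cat_functor_def)
  ultimately show "\<exists>H. cat_functor P G H \<and> (\<forall>x\<in>mor L. H (i x) = F x)" by blast
qed


subsection \<open>Existence\<close>

text \<open>
  The fundamental groupoid is the subgroupoid generated by \<open>L\<close> in the product of all
  pairs of a groupoid in \<open>'a expr\<close> and a functor from \<open>L\<close> to it.
\<close>

type_synonym 'a test = "'a expr cat \<times> ('a \<Rightarrow> 'a expr)"

definition tests :: "'a cat \<Rightarrow> 'a test set" where
  "tests L = {(G, F). groupoid G \<and> cat_functor L G F}"

definition test_product :: "'a cat \<Rightarrow> ('a test \<Rightarrow> 'a expr) cat" where
  "test_product L =
     \<lparr>mor = (\<Pi>\<^sub>E t\<in>tests L. mor (fst t)),
      rng = (\<lambda>x. \<lambda>t\<in>tests L. rng (fst t) (x t)),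
      src = (\<lambda>x. \<lambda>t\<in>tests L. src (fst t) (x t)),
      cmp = (\<lambda>x y. \<lambda>t\<in>tests L. cmp (fst t) (x t) (y t))\<rparr>"

definition test_diagonal :: "'a cat \<Rightarrow> 'a \<Rightarrow> 'a test \<Rightarrow> 'a expr" where
  "test_diagonal L x = (\<lambda>t\<in>tests L. snd t x)"

lemma groupoid_test_product: "groupoid (test_product L)"
proof -
  have G: "groupoid (fst t)" if "t \<in> tests L" for t
    using that by (auto simp: tests_def)
  then have C: "category (fst t)" if "t \<in> tests L" for t
    using that by (blast dest: groupoid.axioms)
  have pt: "src (fst t) (x t) = rng (fst t) (y t)"
    if "src (test_product L) x = rng (test_product L) y" "t \<in> tests L" for x y t
    using fun_cong[OF that(1), of t] that(2) by (simp add: test_product_def)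
  have mem: "x t \<in> mor (fst t)" if "x \<in> mor (test_product L)" "t \<in> tests L" for x t
    using that by (auto simp: test_product_def)
  have ext: "x = y" if "x \<in> mor (test_product L)" "y \<in> mor (test_product L)"
    "\<And>t. t \<in> tests L \<Longrightarrow> x t = y t" for x y
    using that by (auto simp: test_product_def intro: PiE_ext)
  have app: "rng (test_product L) x t = rng (fst t) (x t)"
    "src (test_product L) x t = src (fst t) (x t)"
    "cmp (test_product L) x y t = cmp (fst t) (x t) (y t)" if "t \<in> tests L" for x y t
    using that by (simp_all add: test_product_def)
  have rm: "rng (test_product L) x \<in> mor (test_product L)" if "x \<in> mor (test_product L)" for x
    using that category.rng_mor[OF C] by (auto simp: test_product_def)
  have sm: "src (test_product L) x \<in> mor (test_product L)" if "x \<in> mor (test_product L)" for x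
    using that category.src_mor[OF C] by (auto simp: test_product_def)
  have cm: "cmp (test_product L) x y \<in> mor (test_product L)"
    if "x \<in> mor (test_product L)" "y \<in> mor (test_product L)"
      "src (test_product L) x = rng (test_product L) y" for x y
    using category.cmp_mor[OF C] mem[OF that(1)] mem[OF that(2)] pt[OF that(3)]
    by (simp add: test_product_def)
  have sr: "src (test_product L) (rng (test_product L) x) = rng (test_product L) x"
    if "x \<in> mor (test_product L)" for x
    by (rule ext[OF sm[OF rm[OF that]] rm[OF that]]) (simp add: app category.src_rng[OF C] mem[OF that])
  have rs: "rng (test_product L) (src (test_product L) x) = src (test_product L) x"
    if "x \<in> mor (test_product L)" for x
    by (rule ext[OF rm[OF sm[OF that]] sm[OF that]]) (simp add: app category.rng_src[OF C] mem[OF that])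
  show ?thesis
  proof unfold_locales
    fix x assume x: "x \<in> mor (test_product L)"
    define y where "y = (\<lambda>t\<in>tests L. inverse_of (fst t) (x t))"
    have inv: "is_inverse (fst t) (x t) (y t)" if "t \<in> tests L" for t
      using groupoid.is_inverse_inverse_of[OF G[OF that] mem[OF x that]] that
      by (simp add: y_def)
    have y: "y \<in> mor (test_product L)"
      using inv by (auto simp: test_product_def is_inverse_def y_def)
    have s1: "src (test_product L) x = rng (test_product L) y"
      by (rule ext[OF sm[OF x] rm[OF y]]) (use inv in \<open>simp add: app is_inverse_def\<close>)
    have s2: "src (test_product L) y = rng (test_product L) x"
      by (rule ext[OF sm[OF y] rm[OF x]]) (use inv in \<open>simp add: app is_inverse_def\<close>)
    have "cmp (test_product L) x y = rng (test_product L) x"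
      by (rule ext[OF cm[OF x y s1] rm[OF x]]) (use inv in \<open>simp add: app is_inverse_def\<close>)
    moreover have "cmp (test_product L) y x = src (test_product L) x"
      by (rule ext[OF cm[OF y x s2] sm[OF x]]) (use inv in \<open>simp add: app is_inverse_def\<close>)
    ultimately show "\<exists>y. is_inverse (test_product L) x y"
      using y s1 s2 by (auto simp: is_inverse_def)
  next
    fix x assume x: "x \<in> mor (test_product L)"
    show "cmp (test_product L) (rng (test_product L) x) x = x"
      by (rule ext[OF cm[OF rm[OF x] x sr[OF x]] x]) (simp add: app category.cmp_rng[OF C] mem[OF x])
    show "cmp (test_product L) x (src (test_product L) x) = x"
      by (rule ext[OF cm[OF x sm[OF x] rs[OF x, symmetric]] x])
        (simp add: app category.cmp_src[OF C] mem[OF x])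
  next
    fix x y z
    assume x: "x \<in> mor (test_product L)" and y: "y \<in> mor (test_product L)"
      and z: "z \<in> mor (test_product L)"
      and xy: "src (test_product L) x = rng (test_product L) y"
      and yz: "src (test_product L) y = rng (test_product L) z"
    have sxy: "src (test_product L) (cmp (test_product L) x y) = rng (test_product L) z"
      by (rule ext[OF sm[OF cm[OF x y xy]] rm[OF z]])
        (simp add: app category.src_cmp[OF C] mem[OF x] mem[OF y] pt[OF xy] pt[OF yz])
    have ryz: "src (test_product L) x = rng (test_product L) (cmp (test_product L) y z)"
      by (rule ext[OF sm[OF x] rm[OF cm[OF y z yz]]])
        (simp add: app category.rng_cmp[OF C] mem[OF y] mem[OF z] pt[OF xy] pt[OF yz])
    show "cmp (test_product L) (cmp (test_product L) x y) z
        = cmp (test_product L) x (cmp (test_product L) y z)"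
      by (rule ext[OF cm[OF cm[OF x y xy] z sxy] cm[OF x cm[OF y z yz] ryz]])
        (simp add: app category.cmp_assoc[OF C] mem[OF x] mem[OF y] mem[OF z] pt[OF xy] pt[OF yz])
  qed (fact rm sm cm sr rs | (rule ext; simp add: rm sm cm app mem pt category.rng_rng[OF C]
        category.src_src[OF C] category.rng_cmp[OF C] category.src_cmp[OF C]))+
qed

lemma functor_test_diagonal:
  assumes "category L"
  shows "cat_functor L (test_product L) (test_diagonal L)"
proof -
  interpret category L by fact
  have F: "cat_functor L (fst t) (snd t)" if "t \<in> tests L" for t
    using that by (auto simp: tests_def)
  then have "snd t x \<in> mor (fst t)" "snd t (rng L x) = rng (fst t) (snd t x)"
    "snd t (src L x) = src (fst t) (snd t x)" if "t \<in> tests L" "x \<in> mor L" for t x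
    using that by (auto simp: cat_functor_def)
  moreover have "snd t (cmp L x y) = cmp (fst t) (snd t x) (snd t y)"
    if "t \<in> tests L" "x \<in> mor L" "y \<in> mor L" "src L x = rng L y" for t x y
    using that F by (auto simp: cat_functor_def)
  ultimately show ?thesis
    by (auto simp: cat_functor_def test_product_def test_diagonal_def fun_eq_iff)
qed

theorem fundamental_groupoid_exists:
  fixes L :: "'a cat"
  assumes "category L"
  shows "\<exists>(P :: ('a test \<Rightarrow> 'a expr) cat) i. fundamental_groupoid L P i"
proof -
  interpret L: category L by fact
  define T where "T = test_product L"
  define i where "i = test_diagonal L"
  define S where "S = i ` mor L"
  define P where "P = gen_groupoid T S"
  have T: "groupoid T" using groupoid_test_product by (simp add: T_def)
  have iT: "cat_functor L T i" using functor_test_diagonal[OF assms] by (simp add: T_def i_def)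
  have S: "S \<subseteq> mor T" using iT by (auto simp: cat_functor_def S_def)
  have P: "groupoid P" using groupoid_gen[OF T S] by (simp add: P_def)
  have iP: "cat_functor L P i" using functor_into_gen[OF iT] by (simp add: P_def S_def)
  have incP: "cat_functor P T (\<lambda>x. x)" using functor_from_gen[OF T S] by (simp add: P_def)
  interpret T: groupoid T by fact
  interpret P: groupoid P by fact
  have inv: "inverse_of P x = inverse_of T x" if "x \<in> mor P" for x
    using functor_inverse[OF P T incP that] .
  have SP: "S \<subseteq> mor P" using gen_base by (auto simp: P_def)
  have gen: "gen P S = mor P"
  proof
    show "gen P S \<subseteq> mor P" using gen_mor[OF P SP] by blast
    show "mor P \<subseteq> gen P S"
    proof
      fix x assume "x \<in> mor P"
      then have "x \<in> gen T S" by (simp add: P_def)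
      then show "x \<in> gen P S"
      proof induction
        case (gen_base x) then show ?case by (rule gen.gen_base)
      next
        case (gen_inv x)
        then show ?case using gen.gen_inv[of x P S] inv[of x] by (simp add: P_def)
      next
        case (gen_cmp x y)
        then show ?case using gen.gen_cmp[of x P S y] by (simp add: P_def)
      qed
    qed
  qed
  have ends: "rng T x \<in> i ` objs L \<and> src T x \<in> i ` objs L" if "x \<in> gen T S" for x
    using that
  proof induction
    case (gen_base x)
    then obtain a where a: "a \<in> mor L" "x = i a" by (auto simp: S_def)
    then have "rng T x = i (rng L a)" "src T x = i (src L a)"
      using iT by (auto simp: cat_functor_def)
    then show ?case using L.rng_obj L.src_obj a by blast
  next
    case (gen_inv x)
    then have "is_inverse T x (inverse_of T x)"
      using T.is_inverse_inverse_of gen_mor[OF T S] by blast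
    then show ?case using gen_inv by (auto simp: is_inverse_def)
  next
    case (gen_cmp x y)
    then show ?case using gen_mor[OF T S] by (simp add: T.rng_cmp T.src_cmp)
  qed
  have objs: "i ` objs L = objs P"
  proof
    show "i ` objs L \<subseteq> objs P"
      using iP by (force simp: objs_def cat_functor_def)
    show "objs P \<subseteq> i ` objs L"
    proof
      fix x assume "x \<in> objs P"
      then have "x \<in> gen T S" "rng T x = x" by (auto simp: objs_def P_def)
      then show "x \<in> i ` objs L" using ends by metis
    qed
  qed
  have U: "universal_groupoid TYPE(('a test \<Rightarrow> 'a expr) + 'a expr) L P i"
  proof (rule universal_groupoid_generated[OF P iP gen[unfolded S_def]])
    fix G :: "'a expr cat" and F assume "groupoid G" "cat_functor L G F"
    then have t: "(G, F) \<in> tests L" by (simp add: tests_def)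
    have "cat_functor T G (\<lambda>x. x (G, F))"
      using t by (auto simp: cat_functor_def T_def test_product_def dest: PiE_mem)
    from cat_functor_comp[OF incP this]
    have "cat_functor P G (\<lambda>x. x (G, F))" by (simp add: comp_def)
    moreover have "\<forall>x\<in>mor L. i x (G, F) = F x" using t by (simp add: i_def test_diagonal_def)
    ultimately show "\<exists>H. cat_functor P G H \<and> (\<forall>x\<in>mor L. H (i x) = F x)" by blast
  qed
  have "fundamental_groupoid L P i"
    unfolding fundamental_groupoid_def using P iP objs U by blast
  then show ?thesis by blast
qed

end

theory Submission
  imports Defs
begin

text \<open>The nonempty fibres of \<open>iota\<close> are the nonempty hom-sets between objects, so
  injectivity bounds each of these by one element; this is
  \<open>inj_iota_iff_singly_connected\<close>. As \<open>iota\<close> is moreover a functor into a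
  groupoid, it factors through \<open>i\<close>, and an injective composite has an injective first
  factor; \<open>fundamental_groupoid_inj\<close> is this second step.\<close>

lemma (in category) inj_iota_iff_singly_connected:
  "inj_on (iota C) (mor C) \<longleftrightarrow> singly_connected C"
proof
  assume inj: "inj_on (iota C) (mor C)"
  have "finite (hom_set C u v) \<and> card (hom_set C u v) \<le> 1" for u v
  proof -
    have "x = y" if "x \<in> hom_set C u v" "y \<in> hom_set C u v" for x y
      using that by (intro inj_onD[OF inj]) (auto simp: hom_set_def iota_def)
    then have "hom_set C u v = {} \<or> (\<exists>x. hom_set C u v = {x})" by blast
    then show ?thesis by auto
  qed
  then show "singly_connected C" by (simp add: singly_connected_def)
next
  assume sc: "singly_connected C"
  show "inj_on (iota C) (mor C)"
  proof (rule inj_onI)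
    fix x y assume xy: "x \<in> mor C" "y \<in> mor C" "iota C x = iota C y"
    let ?H = "hom_set C (rng C x) (src C x)"
    have "finite ?H" "card ?H \<le> Suc 0"
      using sc xy(1) by (auto simp: singly_connected_def rng_obj src_obj)
    moreover have "x \<in> ?H" "y \<in> ?H" using xy by (auto simp: hom_set_def iota_def)
    ultimately show "x = y" by (auto simp: card_le_Suc0_iff_eq)
  qed
qed

text \<open>The mediating map \<open>H\<close> recovers \<open>F x\<close> from \<open>i x\<close>,
  so \<open>i\<close> cannot identify morphisms that \<open>F\<close> separates.\<close>

lemma fundamental_groupoid_inj:
  fixes G :: "'g cat"
  assumes "fundamental_groupoid L P i" "groupoid G" "cat_functor L G F" "inj_on F (mor L)"
  shows "inj_on i (mor L)"
proof -
  \<comment> \<open>The definition tests only groupoids in one fixed type;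
    \<open>fundamental_groupoid_universal\<close> extends this to the type of
    \<open>G\<close>.\<close>
  obtain H where H: "\<And>x. x \<in> mor L \<Longrightarrow> H (i x) = F x"
    using universal_groupoidD[OF fundamental_groupoid_universal[OF assms(1)] assms(2,3)] by blast
  show ?thesis
  proof (rule inj_onI)
    fix x y assume "x \<in> mor L" "y \<in> mor L" "i x = i y"
    then show "x = y" using H inj_onD[OF assms(4)] by metis
  qed
qed

theorem proposition3p9:
  fixes L :: "'a cat" and k :: nat and d :: "'a \<Rightarrow> nat \<Rightarrow> nat"
  assumes "k_graph L k d"
    and "connected_cat L"
  shows "(inj_on (iota L) (mor L) \<longleftrightarrow> singly_connected L) \<and>
    (singly_connected L \<longrightarrow>
      (\<forall>(P :: 'p cat) (i :: 'a \<Rightarrow> 'p). fundamental_groupoid L P i \<longrightarrow> inj_on i (mor L)))"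
proof -
  interpret k_graph L k d by fact
  show ?thesis
    \<comment> \<open>Here \<open>G\<close> is the pair groupoid on \<open>objs L\<close> and
      \<open>F\<close> is \<open>iota L\<close>, injective by the first equivalence.\<close>
    using inj_iota_iff_singly_connected
      fundamental_groupoid_inj[OF _ groupoid_pair_groupoid cat_functor_iota] by blast
qed

end
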